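(* There exist a submetrizable topological space $X$, a regular, hereditarily paracompact, first-countable topological space $Y$ that is not submetrizable, and a continuous surjective map $f\colon X\to Y$ that is both open and closed.
   Context: A topological space $X$ is submetrizable if there is a topology on the set $X$, contained in the topology of $X$, which is metrizable. All spaces are assumed to be $T_1$ (so regular spaces are $T_1$). A space is hereditarily paracompact if every subspace of it is paracompact. A map is open (closed) if it sends open sets to open sets (closed sets to closed sets). *)

theory Defs
  imports "HOL-Analysis.Analysis"
begin

definition submetrizable_space :: "'a topology \<Rightarrow> bool" where
  "submetrizable_space X \<longleftrightarrow>
     (\<exists>T. topspace T = topspace X \<and> (\<forall>U. openin T U \<longrightarrow> openin X U) \<and> metrizable_space T)"

(* No separation axiom is built in: texts that require paracompact spaces to be Hausdorff
   agree with this definition on regular T1 spaces and their subspaces. *)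
definition paracompact_space :: "'a topology \<Rightarrow> bool" where
  "paracompact_space X \<longleftrightarrow>
     (\<forall>\<U>. (\<forall>U\<in>\<U>. openin X U) \<and> \<Union>\<U> = topspace X \<longrightarrow>
        (\<exists>\<V>. (\<forall>V\<in>\<V>. openin X V) \<and> \<Union>\<V> = topspace X \<and>
             (\<forall>V\<in>\<V>. \<exists>U\<in>\<U>. V \<subseteq> U) \<and> locally_finite_in X \<V>))"

end

theory Submission
  imports Defs
begin

text \<open>
  The space \<open>Y\<close> is the Michael line with every irrational point \<open>p\<close> replaced by two isolated points
  \<open>(p, 0)\<close> and \<open>(p, 1)\<close>. If a metric \<open>d\<close> gave a coarser topology, the positive function
  \<open>p \<mapsto> d (p, 0) (p, 1)\<close> on the irrationals would tend to \<open>0\<close> at every rational, which the Baire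
  category theorem forbids. The space \<open>X\<close> is the strip \<open>\<real> \<times> [0, 1]\<close> with all points over irrationals
  made isolated, and \<open>f\<close> collapses the fibre over a rational to a point, while over an irrational it
  sends the rational heights to \<open>(p, 0)\<close> and the irrational heights to \<open>(p, 1)\<close>. Density of both
  kinds of heights makes \<open>f\<close> open, compactness of \<open>[0, 1]\<close> makes it closed.
\<close>

subsection \<open>Making points isolated\<close>

text \<open>The Bing-Hanner modification of \<open>T\<close>: points of \<open>D\<close> become
  isolated, the others keep their neighbourhoods. Applied to the real line and the irrationals it
  yields the Michael line.\<close>

definition discretize :: "'a topology \<Rightarrow> 'a set \<Rightarrow> 'a topology" where
  "discretize T D = topology (\<lambda>U. U \<subseteq> topspace T \<and>
     (\<forall>x\<in>U - D. \<exists>V. openin T V \<and> x \<in> V \<and> V \<subseteq> U))"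

lemma openin_discretize:
  "openin (discretize T D) U \<longleftrightarrow>
     U \<subseteq> topspace T \<and> (\<forall>x\<in>U - D. \<exists>V. openin T V \<and> x \<in> V \<and> V \<subseteq> U)"
proof -
  have "istopology (\<lambda>U. U \<subseteq> topspace T \<and>
     (\<forall>x\<in>U - D. \<exists>V. openin T V \<and> x \<in> V \<and> V \<subseteq> U))"
    unfolding istopology_def
  proof (intro conjI allI impI)
    fix S S'
    assume S: "S \<subseteq> topspace T \<and> (\<forall>x\<in>S - D. \<exists>V. openin T V \<and> x \<in> V \<and> V \<subseteq> S)"
      and S': "S' \<subseteq> topspace T \<and> (\<forall>x\<in>S' - D. \<exists>V. openin T V \<and> x \<in> V \<and> V \<subseteq> S')"
    show "S \<inter> S' \<subseteq> topspace T" using S by blast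
    show "\<forall>x\<in>S \<inter> S' - D. \<exists>V. openin T V \<and> x \<in> V \<and> V \<subseteq> S \<inter> S'"
    proof
      fix x assume x: "x \<in> S \<inter> S' - D"
      obtain V V' where "openin T V" "x \<in> V" "V \<subseteq> S" "openin T V'" "x \<in> V'" "V' \<subseteq> S'"
        using S S' x by (metis DiffD1 DiffD2 DiffI IntD1 IntD2)
      then show "\<exists>V. openin T V \<and> x \<in> V \<and> V \<subseteq> S \<inter> S'"
        by (intro exI[of _ "V \<inter> V'"]) auto
    qed
  next
    fix K
    assume K: "\<forall>S\<in>K. S \<subseteq> topspace T \<and> (\<forall>x\<in>S - D. \<exists>V. openin T V \<and> x \<in> V \<and> V \<subseteq> S)"
    then show "\<Union>K \<subseteq> topspace T" by blast
    show "\<forall>x\<in>\<Union>K - D. \<exists>V. openin T V \<and> x \<in> V \<and> V \<subseteq> \<Union>K"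
    proof
      fix x assume "x \<in> \<Union>K - D"
      then obtain S where "S \<in> K" "x \<in> S - D" by blast
      then obtain V where "openin T V" "x \<in> V" "V \<subseteq> S" using K by meson
      then show "\<exists>V. openin T V \<and> x \<in> V \<and> V \<subseteq> \<Union>K"
        using \<open>S \<in> K\<close> by blast
    qed
  qed
  then show ?thesis
    by (simp add: discretize_def topology_inverse')
qed

lemma openin_discretizeI: "openin T U \<Longrightarrow> openin (discretize T D) U"
  by (auto simp: openin_discretize openin_subset)

lemma openin_discretize_subset: "U \<subseteq> topspace T \<Longrightarrow> U \<subseteq> D \<Longrightarrow> openin (discretize T D) U"
  by (auto simp: openin_discretize)

lemma topspace_discretize [simp]: "topspace (discretize T D) = topspace T"
  by (metis openin_discretize openin_discretizeI openin_subset openin_topspace subset_antisym)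

lemma openin_discretizeE:
  assumes "openin (discretize T D) U" "x \<in> U" "x \<notin> D"
  obtains V where "openin T V" "x \<in> V" "V \<subseteq> U"
  using assms unfolding openin_discretize by blast

text \<open>Commuting with subspaces reduces hereditary paracompactness of a modified topology to
  plain paracompactness of modified subspaces.\<close>

lemma subtopology_discretize:
  "subtopology (discretize T D) S = discretize (subtopology T S) D"
  unfolding topology_eq
proof (intro allI iffI)
  fix U assume "openin (subtopology (discretize T D) S) U"
  then obtain W where W: "openin (discretize T D) W" "U = W \<inter> S"
    by (auto simp: openin_subtopology)
  show "openin (discretize (subtopology T S) D) U"
    unfolding openin_discretize
  proof (intro conjI ballI)
    show "U \<subseteq> topspace (subtopology T S)"
      using W openin_subset[OF W(1)] by auto
    fix x assume "x \<in> U - D"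
    then obtain V where "openin T V" "x \<in> V" "V \<subseteq> W"
      using W openin_discretizeE[of T D W x] by auto
    then show "\<exists>V. openin (subtopology T S) V \<and> x \<in> V \<and> V \<subseteq> U"
      using W \<open>x \<in> U - D\<close> by (intro exI[of _ "V \<inter> S"]) (auto simp: openin_subtopology)
  qed
next
  fix U assume U: "openin (discretize (subtopology T S) D) U"
  then have US: "U \<subseteq> topspace T \<inter> S"
    using openin_subset by fastforce
  \<comment> \<open>The big union collects every \<open>T\<close>-open set whose trace on
    \<open>S\<close> stays inside \<open>U\<close>, which recovers the points of \<open>U\<close>
    outside \<open>D\<close>; \<open>U \<inter> D\<close> is open because its points are
    isolated.\<close>
  define W where "W = U \<inter> D \<union> \<Union>{V. openin T V \<and> V \<inter> S \<subseteq> U}"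
  have "openin (discretize T D) W"
    using US unfolding W_def
    by (intro openin_Un openin_discretize_subset openin_discretizeI openin_Union) auto
  moreover have "U = W \<inter> S"
  proof
    show "W \<inter> S \<subseteq> U" by (auto simp: W_def)
    show "U \<subseteq> W \<inter> S"
    proof
      fix x assume x: "x \<in> U"
      have "x \<in> W"
      proof (cases "x \<in> D")
        case False
        then obtain V where V: "openin (subtopology T S) V" "x \<in> V" "V \<subseteq> U"
          using openin_discretizeE[OF U x] by blast
        then obtain V' where "openin T V'" "V = V' \<inter> S"
          by (auto simp: openin_subtopology)
        then show ?thesis using V by (auto simp: W_def)
      qed (use x in \<open>auto simp: W_def\<close>)
      then show "x \<in> W \<inter> S" using x US by auto
    qed
  qed
  ultimately show "openin (subtopology (discretize T D) S) U"
    by (auto simp: openin_subtopology)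
qed

section \<open>Countability, separation and covering properties of the modified topology\<close>

lemma first_countable_discretize:
  assumes "first_countable T"
  shows "first_countable (discretize T D)"
  unfolding first_countable_def
proof
  fix x assume x: "x \<in> topspace (discretize T D)"
  show "\<exists>\<B>. countable \<B> \<and> (\<forall>V\<in>\<B>. openin (discretize T D) V) \<and>
             (\<forall>U. openin (discretize T D) U \<and> x \<in> U \<longrightarrow> (\<exists>V\<in>\<B>. x \<in> V \<and> V \<subseteq> U))"
  proof (cases "x \<in> D")
    case True
    then show ?thesis
      using x openin_discretize_subset[of "{x}" T D] by (intro exI[of _ "{{x}}"]) auto
  next
    case False
    obtain \<B> where \<B>: "countable \<B>" "\<forall>V\<in>\<B>. openin T V"
      "\<forall>U. openin T U \<and> x \<in> U \<longrightarrow> (\<exists>V\<in>\<B>. x \<in> V \<and> V \<subseteq> U)"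
      using assms x by (auto simp: first_countable_def)
    show ?thesis
    proof (intro exI[of _ \<B>] conjI allI impI ballI)
      fix U assume "openin (discretize T D) U \<and> x \<in> U"
      then obtain V where "openin T V" "x \<in> V" "V \<subseteq> U"
        using False openin_discretizeE by metis
      then show "\<exists>V\<in>\<B>. x \<in> V \<and> V \<subseteq> U"
        using \<B>(3) by (meson subset_trans)
    qed (use \<B>(1,2) openin_discretizeI in blast)+
  qed
qed

text \<open>The T1 hypothesis is placed on the modified topology, since \<open>T\<close> will be a
  pullback that cannot tell apart two points of one fibre. It makes the singleton of a point of
  \<open>D\<close> clopen; at the other points regularity of \<open>T\<close> does the
  separation.\<close>

lemma regular_space_discretize:
  assumes T: "regular_space T" and t1: "t1_space (discretize T D)"
  shows "regular_space (discretize T D)"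
  unfolding regular_space_def
proof (intro allI impI)
  fix C a
  assume Ca: "closedin (discretize T D) C \<and> a \<in> topspace (discretize T D) - C"
  then have C: "openin (discretize T D) (topspace T - C)" "C \<subseteq> topspace T"
    by (simp_all add: closedin_def)
  show "\<exists>U V. openin (discretize T D) U \<and> openin (discretize T D) V \<and> a \<in> U \<and> C \<subseteq> V \<and> disjnt U V"
  proof (cases "a \<in> D")
    case True
    have "closedin (discretize T D) {a}"
      using t1 Ca by (simp add: closedin_t1_singleton)
    then have "openin (discretize T D) (topspace T - {a})"
      by (simp add: closedin_def)
    moreover have "openin (discretize T D) {a}"
      using True Ca by (intro openin_discretize_subset) auto
    ultimately show ?thesis
      using C Ca by (intro exI[of _ "{a}"] exI[of _ "topspace T - {a}"]) (auto simp: disjnt_def)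
  next
    case False
    obtain W where W: "openin T W" "a \<in> W" "W \<subseteq> topspace T - C"
      using openin_discretizeE[OF C(1) _ False] Ca by auto
    \<comment> \<open>\<open>C\<close> may fail to be closed in \<open>T\<close>, so the larger set
      \<open>topspace T - W\<close>, which is closed there and still misses \<open>a\<close>, is
      separated from \<open>a\<close> instead.\<close>
    have "closedin T (topspace T - W)" "a \<in> topspace T - (topspace T - W)"
      using W Ca by auto
    then obtain U V where "openin T U" "openin T V" "a \<in> U" "topspace T - W \<subseteq> V" "disjnt U V"
      using T[unfolded regular_space_def, rule_format, of "topspace T - W" a] by blast
    moreover have "C \<subseteq> topspace T - W" using W C by auto
    ultimately show ?thesis
      by (meson openin_discretizeI subset_trans)
  qed
qed

text \<open>Open sets of \<open>T\<close> refining the cover near the points outside \<open>D\<close> cover some open set \<open>G\<close>.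
  Paracompactness of the subspace \<open>G\<close> handles these, and everything outside \<open>G\<close> is isolated.\<close>

lemma paracompact_space_discretize:
  assumes T: "hereditarily paracompact_space T"
  shows "paracompact_space (discretize T D)"
  unfolding paracompact_space_def
proof (intro allI impI)
  fix \<U>
  assume \<U>: "(\<forall>U\<in>\<U>. openin (discretize T D) U) \<and> \<Union>\<U> = topspace (discretize T D)"
  define \<W> where "\<W> = {W. openin T W \<and> (\<exists>U\<in>\<U>. W \<subseteq> U)}"
  define G where "G = \<Union>\<W>"
  have \<U>_open: "openin (discretize T D) U" if "U \<in> \<U>" for U
    using \<U> that by blast
  have \<U>_cover: "\<Union>\<U> = topspace T" using \<U> by simp
  have \<W>: "openin T W" if "W \<in> \<W>" for W using that by (simp add: \<W>_def)
  have G: "openin T G" unfolding G_def by (intro openin_Union \<W>)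
  have GT: "G \<subseteq> topspace T" by (rule openin_subset[OF G])
  have rest: "topspace T - G \<subseteq> D"
  proof
    fix x assume x: "x \<in> topspace T - G"
    then obtain U where U: "U \<in> \<U>" "x \<in> U" using \<U>_cover by blast
    show "x \<in> D"
    proof (rule ccontr)
      assume "x \<notin> D"
      then obtain V where "openin T V" "x \<in> V" "V \<subseteq> U"
        using openin_discretizeE[OF \<U>_open[OF U(1)] U(2)] by blast
      then show False using x U unfolding G_def \<W>_def by blast
    qed
  qed
  have "paracompact_space (subtopology T G)"
    using T unfolding hereditarily by blast
  moreover have "\<forall>W\<in>\<W>. openin (subtopology T G) W" "\<Union>\<W> = topspace (subtopology T G)"
    using \<W> G by (simp_all add: openin_open_subtopology GT inf.absorb2) (auto simp: G_def)
  ultimately have "\<exists>\<V>. (\<forall>V\<in>\<V>. openin (subtopology T G) V) \<and> \<Union>\<V> = topspace (subtopology T G) \<and>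
      (\<forall>V\<in>\<V>. \<exists>W\<in>\<W>. V \<subseteq> W) \<and> locally_finite_in (subtopology T G) \<V>"
    by (simp only: paracompact_space_def)
  then obtain \<V> where V0: "\<forall>V\<in>\<V>. openin (subtopology T G) V"
      "\<Union>\<V> = topspace (subtopology T G)" "\<forall>V\<in>\<V>. \<exists>W\<in>\<W>. V \<subseteq> W"
      and lf: "locally_finite_in (subtopology T G) \<V>"
    by (elim exE conjE)
  have \<V>: "\<Union>\<V> = G" "\<And>V. V \<in> \<V> \<Longrightarrow> \<exists>W\<in>\<W>. V \<subseteq> W"
    using V0(2,3) topspace_subtopology_subset[OF GT] by (simp_all only:)
  define \<S> where "\<S> = (\<lambda>x. {x}) ` (topspace T - G)"
  have VT: "openin T V" "V \<subseteq> G" if "V \<in> \<V>" for V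
    using bspec[OF V0(1) that] G by (simp_all add: openin_open_subtopology)
  show "\<exists>\<V>. (\<forall>V\<in>\<V>. openin (discretize T D) V) \<and> \<Union>\<V> = topspace (discretize T D) \<and>
             (\<forall>V\<in>\<V>. \<exists>U\<in>\<U>. V \<subseteq> U) \<and> locally_finite_in (discretize T D) \<V>"
  proof (intro exI[of _ "\<V> \<union> \<S>"] conjI ballI)
    fix V assume V: "V \<in> \<V> \<union> \<S>"
    then show "openin (discretize T D) V"
      using VT rest by (auto simp: \<S>_def intro: openin_discretizeI openin_discretize_subset)
    show "\<exists>U\<in>\<U>. V \<subseteq> U"
    proof (cases "V \<in> \<V>")
      case True
      then obtain W where "W \<in> \<W>" "V \<subseteq> W" using \<V>(2) by blast
      then show ?thesis unfolding \<W>_def by blast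
    next
      case False
      then obtain x where "V = {x}" "x \<in> topspace T" using V by (auto simp: \<S>_def)
      then show ?thesis using \<U>_cover by blast
    qed
  next
    show eq: "\<Union>(\<V> \<union> \<S>) = topspace (discretize T D)"
      using \<V>(1) GT by (auto simp: \<S>_def)
    show "locally_finite_in (discretize T D) (\<V> \<union> \<S>)"
      unfolding locally_finite_in_def
    proof (intro conjI ballI)
      show "\<Union>(\<V> \<union> \<S>) \<subseteq> topspace (discretize T D)" using eq by simp
      fix x assume x: "x \<in> topspace (discretize T D)"
      show "\<exists>V. openin (discretize T D) V \<and> x \<in> V \<and> finite {U \<in> \<V> \<union> \<S>. U \<inter> V \<noteq> {}}"
      proof (cases "x \<in> G")
        case True
        have "x \<in> topspace (subtopology T G)" using True GT by auto
        then obtain V where V: "openin (subtopology T G) V" "x \<in> V"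
            "finite {U \<in> \<V>. U \<inter> V \<noteq> {}}"
          using lf unfolding locally_finite_in_def by blast
        then have "openin T V" "V \<subseteq> G"
          using G by (auto simp: openin_open_subtopology)
        moreover have "{U \<in> \<V> \<union> \<S>. U \<inter> V \<noteq> {}} = {U \<in> \<V>. U \<inter> V \<noteq> {}}"
          using \<open>V \<subseteq> G\<close> by (auto simp: \<S>_def)
        ultimately show ?thesis
          using V by (auto intro!: openin_discretizeI)
      next
        case False
        then have "openin (discretize T D) {x}"
          using x rest by (intro openin_discretize_subset) auto
        \<comment> \<open>A member of \<open>\<V>\<close> lies in \<open>G\<close> and so misses
          \<open>x\<close>; only the singleton \<open>{x}\<close> itself can meet this
          neighbourhood.\<close>
        moreover have "{U \<in> \<V> \<union> \<S>. U \<inter> {x} \<noteq> {}} \<subseteq> {{x}}"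
          using False VT(2) by (auto simp: \<S>_def)
        then have "finite {U \<in> \<V> \<union> \<S>. U \<inter> {x} \<noteq> {}}"
          using finite_subset by blast
        ultimately show ?thesis by blast
      qed
    qed
  qed
qed

lemma hereditarily_paracompact_discretize:
  assumes "hereditarily paracompact_space T"
  shows "hereditarily paracompact_space (discretize T D)"
  unfolding hereditarily subtopology_discretize
proof
  fix S
  have "hereditarily paracompact_space (subtopology T S)"
    using assms by (simp add: hereditarily subtopology_subtopology)
  then show "paracompact_space (discretize (subtopology T S) D)"
    by (rule paracompact_space_discretize)
qed

subsection \<open>Pullback topologies\<close>

lemma subtopology_pullback_topology:
  "subtopology (pullback_topology A f T) S = pullback_topology (A \<inter> S) f T"
  unfolding topology_eq openin_subtopology openin_pullback_topology by (auto simp: Int_assoc)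

text \<open>A closed set of the pullback lies over a closed set of \<open>T\<close> that misses
  \<open>f a\<close>; disjoint open sets separating these in \<open>T\<close> have disjoint
  preimages.\<close>

lemma regular_space_pullback_topology:
  assumes "regular_space T"
  shows "regular_space (pullback_topology A f T)"
  unfolding regular_space_def
proof (intro allI impI)
  fix C a
  assume C: "closedin (pullback_topology A f T) C \<and> a \<in> topspace (pullback_topology A f T) - C"
  then obtain W where W: "openin T W" "f -` topspace T \<inter> A - C = f -` W \<inter> A"
    by (auto simp: closedin_def openin_pullback_topology topspace_pullback_topology)
  have "C \<subseteq> f -` topspace T \<inter> A" "a \<in> f -` W \<inter> A"
    using C W(2) by (auto simp: closedin_def topspace_pullback_topology)
  then have "C \<subseteq> f -` (topspace T - W) \<inter> A" using W(2) by blast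
  moreover have "closedin T (topspace T - W)" "f a \<in> topspace T - (topspace T - W)"
    using W(1) openin_subset[OF W(1)] \<open>a \<in> f -` W \<inter> A\<close> by auto
  then obtain U V where "openin T U" "openin T V" "f a \<in> U" "topspace T - W \<subseteq> V" "disjnt U V"
    using assms[unfolded regular_space_def, rule_format, of "topspace T - W" "f a"] by blast
  ultimately have "openin (pullback_topology A f T) (f -` U \<inter> A)"
      "openin (pullback_topology A f T) (f -` V \<inter> A)"
      "a \<in> f -` U \<inter> A" "C \<subseteq> f -` V \<inter> A" "disjnt (f -` U \<inter> A) (f -` V \<inter> A)"
    using \<open>a \<in> f -` W \<inter> A\<close> by (auto simp: openin_pullback_topology disjnt_def)
  then show "\<exists>U V. openin (pullback_topology A f T) U \<and> openin (pullback_topology A f T) V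
               \<and> a \<in> U \<and> C \<subseteq> V \<and> disjnt U V"
    by blast
qed

lemma first_countable_pullback_topology:
  assumes "first_countable T"
  shows "first_countable (pullback_topology A f T)"
  unfolding first_countable_def
proof
  fix x assume x: "x \<in> topspace (pullback_topology A f T)"
  then have "f x \<in> topspace T" "x \<in> A" by (auto simp: topspace_pullback_topology)
  then obtain \<B> where \<B>: "countable \<B>" "\<forall>V\<in>\<B>. openin T V"
      "\<forall>U. openin T U \<and> f x \<in> U \<longrightarrow> (\<exists>V\<in>\<B>. f x \<in> V \<and> V \<subseteq> U)"
    using assms unfolding first_countable_def by meson
  show "\<exists>\<B>. countable \<B> \<and> (\<forall>V\<in>\<B>. openin (pullback_topology A f T) V) \<and>
             (\<forall>U. openin (pullback_topology A f T) U \<and> x \<in> U \<longrightarrow> (\<exists>V\<in>\<B>. x \<in> V \<and> V \<subseteq> U))"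
  proof (intro exI[of _ "(\<lambda>V. f -` V \<inter> A) ` \<B>"] conjI allI impI ballI)
    fix U assume "openin (pullback_topology A f T) U \<and> x \<in> U"
    then obtain W where W: "openin T W" "U = f -` W \<inter> A" "x \<in> U"
      by (auto simp: openin_pullback_topology)
    then obtain V where "V \<in> \<B>" "f x \<in> V" "V \<subseteq> W" using \<B>(3) by blast
    then show "\<exists>V\<in>(\<lambda>V. f -` V \<inter> A) ` \<B>. x \<in> V \<and> V \<subseteq> U"
      using W \<open>x \<in> A\<close> by auto
  qed (use \<B>(1,2) in \<open>auto simp: openin_pullback_topology\<close>)
qed

text \<open>The image of \<open>A\<close> under \<open>f\<close> sits in a separable metric space; a
  locally finite open refinement there, given by \<open>paracompact\<close>, pulls back along
  \<open>f\<close>.\<close>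

lemma paracompact_space_pullback_topology:
  fixes f :: "'a \<Rightarrow> 'b :: {metric_space, second_countable_topology}"
  shows "paracompact_space (pullback_topology A f euclidean)"
  unfolding paracompact_space_def
proof (intro allI impI)
  let ?T = "pullback_topology A f euclidean"
  fix \<U>
  assume \<U>: "(\<forall>U\<in>\<U>. openin ?T U) \<and> \<Union>\<U> = topspace ?T"
  have top: "topspace ?T = A" by (simp add: topspace_pullback_topology)
  \<comment> \<open>A member of the cover may be the preimage of several open sets; all of them are
    collected, and together they cover the image of \<open>A\<close>.\<close>
  define \<C> where "\<C> = {W. open W \<and> f -` W \<inter> A \<in> \<U>}"
  have sub: "f ` A \<subseteq> \<Union>\<C>"
  proof clarify
    fix a assume "a \<in> A"
    then obtain U where U: "U \<in> \<U>" "a \<in> U" using \<U> top by auto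
    then obtain W where "open W" "U = f -` W \<inter> A"
      using \<U> by (auto simp: openin_pullback_topology)
    then show "f a \<in> \<Union>\<C>" using U by (auto simp: \<C>_def)
  qed
  obtain \<C>' where \<C>': "f ` A \<subseteq> \<Union>\<C>'"
      "\<And>U. U \<in> \<C>' \<Longrightarrow> open U \<and> (\<exists>T. T \<in> \<C> \<and> U \<subseteq> T)"
      "\<And>x. x \<in> f ` A \<Longrightarrow> \<exists>V. open V \<and> x \<in> V \<and> finite {U. U \<in> \<C>' \<and> (U \<inter> V \<noteq> {})}"
    by (rule paracompact[OF sub]) (auto simp: \<C>_def)
  show "\<exists>\<V>. (\<forall>V\<in>\<V>. openin ?T V) \<and> \<Union>\<V> = topspace ?T \<and>
             (\<forall>V\<in>\<V>. \<exists>U\<in>\<U>. V \<subseteq> U) \<and> locally_finite_in ?T \<V>"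
  proof (intro exI[of _ "(\<lambda>W. f -` W \<inter> A) ` \<C>'"] conjI ballI)
    fix V assume "V \<in> (\<lambda>W. f -` W \<inter> A) ` \<C>'"
    then obtain W where W: "W \<in> \<C>'" "V = f -` W \<inter> A" by blast
    then show "openin ?T V" using \<C>'(2) by (auto simp: openin_pullback_topology)
    obtain W' where "W' \<in> \<C>" "W \<subseteq> W'" using \<C>'(2) W by blast
    then have "f -` W' \<inter> A \<in> \<U>" "V \<subseteq> f -` W' \<inter> A" using W by (auto simp: \<C>_def)
    then show "\<exists>U\<in>\<U>. V \<subseteq> U" by blast
  next
    show eq: "\<Union>((\<lambda>W. f -` W \<inter> A) ` \<C>') = topspace ?T"
      using \<C>'(1) by (auto simp: top)
    show "locally_finite_in ?T ((\<lambda>W. f -` W \<inter> A) ` \<C>')"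
      unfolding locally_finite_in_def
    proof (intro conjI ballI)
      show "\<Union>((\<lambda>W. f -` W \<inter> A) ` \<C>') \<subseteq> topspace ?T" using eq by simp
      fix x assume "x \<in> topspace ?T"
      then have "x \<in> A" by (simp add: top)
      then obtain V where V: "open V" "f x \<in> V" "finite {U. U \<in> \<C>' \<and> (U \<inter> V \<noteq> {})}"
        using \<C>'(3) by blast
      \<comment> \<open>A point common to two preimages is mapped into both sets, so only the
        finitely many members of \<open>\<C>'\<close> that meet \<open>V\<close> can
        contribute.\<close>
      have "{U \<in> (\<lambda>W. f -` W \<inter> A) ` \<C>'. U \<inter> (f -` V \<inter> A) \<noteq> {}}
              \<subseteq> (\<lambda>W. f -` W \<inter> A) ` {U. U \<in> \<C>' \<and> (U \<inter> V \<noteq> {})}"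
        by auto
      then have "finite {U \<in> (\<lambda>W. f -` W \<inter> A) ` \<C>'. U \<inter> (f -` V \<inter> A) \<noteq> {}}"
        by (rule finite_surj[OF V(3)])
      then show "\<exists>V. openin ?T V \<and> x \<in> V \<and> finite {U \<in> (\<lambda>W. f -` W \<inter> A) ` \<C>'. U \<inter> V \<noteq> {}}"
        using V(1,2) \<open>x \<in> A\<close>
        by (intro exI[of _ "f -` V \<inter> A"] conjI) (auto simp: openin_pullback_topology)
    qed
  qed
qed

lemma hereditarily_paracompact_pullback_topology:
  fixes f :: "'a \<Rightarrow> 'b :: {metric_space, second_countable_topology}"
  shows "hereditarily paracompact_space (pullback_topology A f euclidean)"
  by (simp add: hereditarily subtopology_pullback_topology paracompact_space_pullback_topology)

subsection \<open>The doubled Michael line\<close>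

text \<open>Baire category: the open sets on whose irrationals \<open>e\<close> is small are dense,
  and so are the complements of single rationals. A point common to all of them is an irrational
  where \<open>e\<close> is below every positive bound.\<close>

lemma no_positive_function_vanishing_at_rationals:
  fixes e :: "real \<Rightarrow> real"
  assumes e: "\<And>q r. q \<in> \<rat> \<Longrightarrow> r > 0 \<Longrightarrow>
                \<exists>U. open U \<and> q \<in> U \<and> (\<forall>p\<in>U - \<rat>. e p < r)"
  shows "\<exists>p. p \<notin> \<rat> \<and> e p \<le> 0"
proof -
  \<comment> \<open>\<open>G n\<close> is the largest open set on whose irrationals \<open>e\<close>
    stays below \<open>1 / (n + 1)\<close>; by hypothesis it contains the rationals, hence is
    dense.\<close>
  define G where "G n = \<Union>{U. open U \<and> (\<forall>p\<in>U - \<rat>. e p < inverse (real (Suc n)))}" for n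
  \<comment> \<open>Removing the rationals one at a time adds only countably many dense open sets
    and forces the common point to be irrational.\<close>
  define \<G> where "\<G> = range G \<union> (\<lambda>q. - {q}) ` (\<rat> :: real set)"
  have dense_rat: "closure (\<rat> :: real set) = UNIV"
    using Rats_closure_real by simp
  have G: "open (G n)" "\<rat> \<subseteq> G n" for n
    using e[of _ "inverse (real (Suc n))"] by (auto simp: G_def)
  have "(UNIV :: real set) \<subseteq> closure (\<Inter>\<G>)"
  proof (rule Baire)
    show "countable \<G>" by (auto simp: \<G>_def countable_rat)
    fix S assume "S \<in> \<G>"
    then consider n where "S = G n" | q where "S = - {q}" by (auto simp: \<G>_def)
    then show "openin (top_of_set UNIV) S \<and> UNIV \<subseteq> closure S"
    proof cases
      case 1
      then show ?thesis using G[of n] closure_mono[of \<rat> "G n"] dense_rat by auto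
    next
      case 2
      then show ?thesis by (auto simp: closure_complement)
    qed
  qed auto
  then have "\<Inter>\<G> \<noteq> {}" by auto
  then obtain p where p: "p \<in> \<Inter>\<G>" by blast
  have "p \<notin> \<rat>" using p by (auto simp: \<G>_def)
  moreover have "e p < inverse (real (Suc n))" for n
  proof -
    have "p \<in> G n" using p by (auto simp: \<G>_def)
    then show ?thesis using \<open>p \<notin> \<rat>\<close> by (auto simp: G_def)
  qed
  then have "e p \<le> 0"
    by (meson less_asym not_le reals_Archimedean)
  ultimately show ?thesis by blast
qed

section \<open>The two spaces and the map between them\<close>

abbreviation irrational_fibres :: "(real \<times> real) set" where
  "irrational_fibres \<equiv> fst -` (- \<rat>)"

text \<open>The label 0 or 1 is a real number, so that line and strip live in the same type,
  \<open>fst\<close> projects both, and \<open>irrational_fibres\<close> serves for both.\<close>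

definition doubled_line :: "(real \<times> real) set" where
  "doubled_line = {(x, i). i = 0 \<or> i = 1 \<and> x \<notin> \<rat>}"

text \<open>The pullback along \<open>fst\<close> alone leaves \<open>(p, 0)\<close> and
  \<open>(p, 1)\<close> indistinguishable for irrational \<open>p\<close>; making them isolated
  separates them.\<close>

definition doubled_Michael_line :: "(real \<times> real) topology" where
  "doubled_Michael_line =
     discretize (pullback_topology doubled_line fst euclidean) irrational_fibres"

definition Michael_strip :: "(real \<times> real) topology" where
  "Michael_strip = discretize (top_of_set (UNIV \<times> {0..1})) irrational_fibres"

definition strip_map :: "real \<times> real \<Rightarrow> real \<times> real" where
  "strip_map = (\<lambda>(x, t). (x, if x \<in> \<rat> \<or> t \<in> \<rat> then 0 else 1))"

lemma topspace_doubled_Michael_line [simp]: "topspace doubled_Michael_line = doubled_line"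
  by (simp add: doubled_Michael_line_def topspace_pullback_topology)

lemma topspace_Michael_strip [simp]: "topspace Michael_strip = UNIV \<times> {0..1}"
  by (simp add: Michael_strip_def)

text \<open>Points over irrationals are isolated and a rational has only the copy labelled 0, so
  only the points \<open>(x, 0)\<close> with \<open>x\<close> rational constrain \<open>V\<close>.
  Basic neighbourhoods there consist of whole fibres, so they contain both copies of every nearby
  irrational.\<close>

lemma openin_doubled_Michael_line:
  "openin doubled_Michael_line V \<longleftrightarrow> V \<subseteq> doubled_line \<and>
     (\<forall>x. (x, 0) \<in> V \<longrightarrow> x \<in> \<rat> \<longrightarrow> (\<exists>U. open U \<and> x \<in> U \<and> fst -` U \<inter> doubled_line \<subseteq> V))"
  (is "?L \<longleftrightarrow> ?R")
proof
  assume L: ?L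
  show ?R
  proof (intro conjI allI impI)
    show "V \<subseteq> doubled_line" using openin_subset[OF L] by simp
    fix x assume x: "(x, 0) \<in> V" "x \<in> \<rat>"
    obtain W where "openin (pullback_topology doubled_line fst euclidean) W" "(x, 0) \<in> W" "W \<subseteq> V"
      using openin_discretizeE[OF L[unfolded doubled_Michael_line_def] x(1)] x(2) by auto
    then show "\<exists>U. open U \<and> x \<in> U \<and> fst -` U \<inter> doubled_line \<subseteq> V"
      by (auto simp: openin_pullback_topology)
  qed
next
  assume R: ?R
  show ?L
    unfolding doubled_Michael_line_def openin_discretize
  proof (intro conjI ballI)
    show "V \<subseteq> topspace (pullback_topology doubled_line fst euclidean)"
      using R by (simp add: topspace_pullback_topology)
    fix z assume z: "z \<in> V - irrational_fibres"
    then obtain x where x: "z = (x, 0)" "x \<in> \<rat>"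
      using R by (auto simp: doubled_line_def)
    then obtain U where "open U" "x \<in> U" "fst -` U \<inter> doubled_line \<subseteq> V"
      using R z by blast
    then show "\<exists>W. openin (pullback_topology doubled_line fst euclidean) W \<and> z \<in> W \<and> W \<subseteq> V"
      using x by (intro exI[of _ "fst -` U \<inter> doubled_line"])
        (auto simp: openin_pullback_topology doubled_line_def)
  qed
qed

lemma t1_space_doubled_Michael_line: "t1_space doubled_Michael_line"
  unfolding t1_space_def topspace_doubled_Michael_line
proof (intro ballI impI)
  fix a b :: "real \<times> real"
  assume ab: "a \<in> doubled_line" "b \<in> doubled_line" "a \<noteq> b"
  show "\<exists>U. openin doubled_Michael_line U \<and> a \<in> U \<and> b \<notin> U"
  proof (cases "fst a = fst b")
    case True
    \<comment> \<open>Two distinct points of one fibre can only lie over an irrational, where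
      singletons are open.\<close>
    then have "openin doubled_Michael_line {a}"
      using ab by (auto simp: openin_doubled_Michael_line doubled_line_def)
    then show ?thesis using ab by blast
  next
    case False
    have "openin doubled_Michael_line (fst -` (- {fst b}) \<inter> doubled_line)"
      unfolding openin_doubled_Michael_line by (auto intro!: exI[of _ "- {fst b}"])
    then show ?thesis using False ab by blast
  qed
qed

lemma not_submetrizable_doubled_Michael_line: "\<not> submetrizable_space doubled_Michael_line"
proof
  assume "submetrizable_space doubled_Michael_line"
  then obtain T where T: "topspace T = doubled_line" "metrizable_space T"
      "\<And>U. openin T U \<Longrightarrow> openin doubled_Michael_line U"
    by (auto simp: submetrizable_space_def)
  then obtain M d where "Metric_space M d" and Td: "T = Metric_space.mtopology M d"
    by (auto simp: metrizable_space_def)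
  interpret Metric_space M d by fact
  have M: "M = doubled_line" using T Td by simp
  have "\<exists>p. p \<notin> \<rat> \<and> d (p, 0) (p, 1) \<le> 0"
  proof (rule no_positive_function_vanishing_at_rationals)
    fix q r :: real assume q: "q \<in> \<rat>" and r: "r > 0"
    \<comment> \<open>The ball contains both copies of every irrational near \<open>q\<close>; with
      radius \<open>r / 2\<close> the triangle inequality through \<open>(q, 0)\<close> puts their
      distance below \<open>r\<close>.\<close>
    have "openin doubled_Michael_line (mball (q, 0) (r / 2))"
      using T Td openin_mball by blast
    moreover have "(q, 0) \<in> M" by (simp add: M doubled_line_def)
    then have "(q, 0) \<in> mball (q, 0) (r / 2)"
      using r by (intro centre_in_mball_iff[THEN iffD2]) simp
    ultimately obtain U where U: "open U" "q \<in> U"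
        "fst -` U \<inter> doubled_line \<subseteq> mball (q, 0) (r / 2)"
      using q unfolding openin_doubled_Michael_line by blast
    show "\<exists>U. open U \<and> q \<in> U \<and> (\<forall>p\<in>U - \<rat>. d (p, 0) (p, 1) < r)"
    proof (intro exI[of _ U] conjI U ballI)
      fix p assume p: "p \<in> U - \<rat>"
      then have "(p, 0) \<in> fst -` U \<inter> doubled_line" "(p, 1) \<in> fst -` U \<inter> doubled_line"
        by (auto simp: doubled_line_def)
      then have "(p, 0) \<in> mball (q, 0) (r / 2)" "(p, 1) \<in> mball (q, 0) (r / 2)"
        using U(3) by blast+
      then show "d (p, 0) (p, 1) < r"
        using triangle''[of "(p, 0)" "(q, 0)" "(p, 1)"] by (auto simp: commute)
    qed
  qed
  then obtain p where "p \<notin> \<rat>" "d (p, 0) (p, 1) \<le> 0" by blast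
  moreover from \<open>p \<notin> \<rat>\<close> have "(p, 0) \<in> M" "(p, 1) \<in> M" by (auto simp: M doubled_line_def)
  ultimately show False
    using zero[of "(p, 0)" "(p, 1)"] nonneg[of "(p, 0)" "(p, 1)"] by simp
qed

subsection \<open>The strip and the map\<close>

lemma submetrizable_discretize: "metrizable_space T \<Longrightarrow> submetrizable_space (discretize T D)"
  unfolding submetrizable_space_def by (intro exI[of _ T]) (auto intro: openin_discretizeI)

lemma submetrizable_imp_t1_space: "submetrizable_space X \<Longrightarrow> t1_space X"
  unfolding submetrizable_space_def
  using t1_space_expansive[of X] metrizable_imp_t1_space by metis

lemma strip_map_in_doubled_line: "strip_map z \<in> doubled_line"
  by (cases z) (auto simp: strip_map_def doubled_line_def)

lemma fst_strip_map [simp]: "fst (strip_map z) = fst z"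
  by (cases z) (auto simp: strip_map_def)

text \<open>Every interval contains rational and irrational heights, so each point of the fibre over
  \<open>x\<close> is hit from within it. The interval from 0 to 1 gives surjectivity, short
  intervals give openness of the map.\<close>

lemma strip_map_onto:
  assumes "(x, i) \<in> doubled_line" "a < b"
  shows "\<exists>t. a < t \<and> t < b \<and> strip_map (x, t) = (x, i)"
proof -
  obtain r where r: "r \<in> \<rat>" "a < r" "r < b" using Rats_dense_in_real[OF \<open>a < b\<close>] by blast
  have "uncountable ({a<..<b} - \<rat>)"
    using \<open>a < b\<close> by (simp add: uncountable_open_interval uncountable_minus_countable countable_rat)
  then obtain s where s: "s \<notin> \<rat>" "a < s" "s < b"
    by (metis DiffE ex_in_conv countable_empty greaterThanLessThan_iff)
  show ?thesis
    using assms(1) r s by (auto simp: doubled_line_def strip_map_def)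
qed

lemma image_strip_map: "strip_map ` (UNIV \<times> {0..1}) = doubled_line"
proof (intro equalityI subsetI)
  fix z assume z: "z \<in> doubled_line"
  then obtain t where "0 < t" "t < 1" "strip_map (fst z, t) = z"
    using strip_map_onto[of "fst z" "snd z" 0 1] by auto
  then show "z \<in> strip_map ` (UNIV \<times> {0..1})" by (metis SigmaI UNIV_I atLeastAtMost_iff
      image_eqI less_imp_le)
qed (auto simp: strip_map_in_doubled_line)

lemma openin_Michael_strip_fstI:
  assumes "W \<subseteq> UNIV \<times> {0..1}"
    "\<And>x t. (x, t) \<in> W \<Longrightarrow> x \<in> \<rat> \<Longrightarrow> \<exists>V. open V \<and> (x, t) \<in> V \<and> V \<inter> UNIV \<times> {0..1} \<subseteq> W"
  shows "openin Michael_strip W"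
  unfolding Michael_strip_def openin_discretize
proof (intro conjI ballI)
  fix z assume z: "z \<in> W - irrational_fibres"
  then obtain V where "open V" "z \<in> V" "V \<inter> UNIV \<times> {0..1} \<subseteq> W"
    using assms(2)[of "fst z" "snd z"] by auto
  then show "\<exists>V. openin (top_of_set (UNIV \<times> {0..1})) V \<and> z \<in> V \<and> V \<subseteq> W"
    using z assms(1) by (intro exI[of _ "V \<inter> UNIV \<times> {0..1}"])
      (auto simp: openin_open_Int Int_commute[of V])
qed (use assms in auto)

lemma openin_Michael_stripE:
  assumes "openin Michael_strip W" "(x, t) \<in> W" "x \<in> \<rat>"
  obtains V where "open V" "(x, t) \<in> V" "V \<inter> UNIV \<times> {0..1} \<subseteq> W"
proof -
  obtain V where V: "openin (top_of_set (UNIV \<times> {0..1})) V" "(x, t) \<in> V" "V \<subseteq> W"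
    using openin_discretizeE[OF assms(1)[unfolded Michael_strip_def] assms(2)] assms(3) by auto
  then obtain V' where "open V'" "V = UNIV \<times> {0..1} \<inter> V'" by (auto simp: openin_open)
  then show thesis using that[of V'] V by blast
qed

section \<open>Continuity, openness and closedness of the map\<close>

lemma continuous_map_strip_map: "continuous_map Michael_strip doubled_Michael_line strip_map"
  unfolding continuous_map_def
proof (intro conjI allI impI)
  show "strip_map \<in> topspace Michael_strip \<rightarrow> topspace doubled_Michael_line"
    by (auto simp: strip_map_in_doubled_line)
  fix V assume V: "openin doubled_Michael_line V"
  show "openin Michael_strip {z \<in> topspace Michael_strip. strip_map z \<in> V}"
  proof (rule openin_Michael_strip_fstI)
    fix x t assume *: "(x, t) \<in> {z \<in> topspace Michael_strip. strip_map z \<in> V}" "x \<in> \<rat>"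
    then have "(x, 0) \<in> V" by (simp add: strip_map_def)
    then obtain U where U: "open U" "x \<in> U" "fst -` U \<inter> doubled_line \<subseteq> V"
      using V * by (auto simp: openin_doubled_Michael_line)
    \<comment> \<open>The vertical band over \<open>U\<close> works, because
      \<open>strip_map\<close> preserves first coordinates and \<open>V\<close> contains the whole
      fibres over \<open>U\<close>.\<close>
    show "\<exists>W. open W \<and> (x, t) \<in> W \<and>
            W \<inter> UNIV \<times> {0..1} \<subseteq> {z \<in> topspace Michael_strip. strip_map z \<in> V}"
      using U by (intro exI[of _ "U \<times> UNIV"])
        (auto simp: open_Times intro!: subsetD[OF U(3)] strip_map_in_doubled_line)
  qed auto
qed

lemma open_map_strip_map: "open_map Michael_strip doubled_Michael_line strip_map"
  unfolding open_map_def
proof (intro allI impI)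
  fix W assume W: "openin Michael_strip W"
  show "openin doubled_Michael_line (strip_map ` W)"
    unfolding openin_doubled_Michael_line
  proof (intro conjI allI impI)
    show "strip_map ` W \<subseteq> doubled_line" by (auto simp: strip_map_in_doubled_line)
    fix x assume x: "(x, 0) \<in> strip_map ` W" "x \<in> \<rat>"
    then obtain t where t: "(x, t) \<in> W" by (force simp: strip_map_def)
    then have "t \<in> {0..1}" using openin_subset[OF W] by auto
    obtain V where V: "open V" "(x, t) \<in> V" "V \<inter> UNIV \<times> {0..1} \<subseteq> W"
      using openin_Michael_stripE[OF W t x(2)] by blast
    obtain A B where AB: "open A" "open B" "x \<in> A" "t \<in> B" "A \<times> B \<subseteq> V"
      using open_prod_elim[OF V(1,2)] by (metis mem_Sigma_iff)
    obtain e where e: "e > 0" "{t - e<..<t + e} \<subseteq> B"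
      using AB by (metis open_real_greaterThanLessThan open_contains_ball ball_eq_greaterThanLessThan)
    show "\<exists>U. open U \<and> x \<in> U \<and> fst -` U \<inter> doubled_line \<subseteq> strip_map ` W"
    proof (intro exI[of _ A] conjI AB subsetI)
      fix z assume z: "z \<in> fst -` A \<inter> doubled_line"
      \<comment> \<open>Clipping to the unit interval leaves a nonempty interval even when
        \<open>t\<close> is 0 or 1. Heights chosen in it stay in the strip and in \<open>B\<close>,
        so every point over \<open>A\<close> is attained on \<open>W\<close>.\<close>
      have "max 0 (t - e) < min 1 (t + e)" using \<open>t \<in> {0..1}\<close> e by auto
      moreover have "(fst z, snd z) \<in> doubled_line" using z by simp
      ultimately obtain s where s: "max 0 (t - e) < s" "s < min 1 (t + e)"
          "strip_map (fst z, s) = z"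
        using strip_map_onto by (metis prod.collapse)
      then have "(fst z, s) \<in> A \<times> B" using e z by auto
      then have "(fst z, s) \<in> W" using s V AB by auto
      then show "z \<in> strip_map ` W" using s by force
    qed
  qed
qed

text \<open>If \<open>(x, 0)\<close> with \<open>x\<close> rational is not in the image of
  \<open>C\<close>, the compact fibre over \<open>x\<close> misses \<open>C\<close>; by the tube
  lemma so do all fibres over a neighbourhood of \<open>x\<close>.\<close>

lemma closed_map_strip_map: "closed_map Michael_strip doubled_Michael_line strip_map"
  unfolding closed_map_def
proof (intro allI impI)
  fix C assume C: "closedin Michael_strip C"
  have "openin doubled_Michael_line (doubled_line - strip_map ` C)"
    unfolding openin_doubled_Michael_line
  proof (intro conjI allI impI)
    fix x assume x: "(x, 0) \<in> doubled_line - strip_map ` C" "x \<in> \<rat>"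
    \<comment> \<open>The tube lemma needs a set open in the plane, so \<open>W\<close> is the
      largest such set whose part in the strip avoids \<open>C\<close>. Over irrationals it may be
      smaller than the complement of \<open>C\<close>, but it contains the fibre over
      \<open>x\<close>.\<close>
    define W where "W = \<Union>{V. open V \<and> V \<inter> UNIV \<times> {0..1} \<subseteq> UNIV \<times> {0..1} - C}"
    have "{x} \<times> {0..1} \<subseteq> W"
    proof clarify
      fix t :: real assume t: "t \<in> {0..1}"
      have "strip_map (x, t) = (x, 0)" using x(2) by (simp add: strip_map_def)
      then have "(x, t) \<notin> C" using x(1) by force
      then obtain V where "open V" "(x, t) \<in> V" "V \<inter> UNIV \<times> {0..1} \<subseteq> UNIV \<times> {0..1} - C"
        using openin_Michael_stripE[of "UNIV \<times> {0..1} - C" x t] C x(2) t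
        by (auto simp: closedin_def)
      then show "(x, t) \<in> W" by (auto simp: W_def)
    qed
    moreover have "open W" by (auto simp: W_def)
    ultimately obtain U where U: "x \<in> U" "open U" "U \<times> {0..1} \<subseteq> W"
      using Elementary_Topology.tube_lemma[of "{0..1}" W x] by auto
    show "\<exists>U. open U \<and> x \<in> U \<and> fst -` U \<inter> doubled_line \<subseteq> doubled_line - strip_map ` C"
    proof (intro exI[of _ U] conjI U subsetI)
      fix z assume z: "z \<in> fst -` U \<inter> doubled_line"
      have "z \<notin> strip_map ` C"
      proof
        assume "z \<in> strip_map ` C"
        then obtain c where c: "c \<in> C" "z = strip_map c" by blast
        then have "c \<in> UNIV \<times> {0..1}" using closedin_subset[OF C] by auto
        then have "c \<in> W" using U(3) z c by (cases c) auto
        then show False using c \<open>c \<in> UNIV \<times> {0..1}\<close> by (auto simp: W_def)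
      qed
      then show "z \<in> doubled_line - strip_map ` C" using z by blast
    qed
  qed auto
  then show "closedin doubled_Michael_line (strip_map ` C)"
    by (auto simp: closedin_def strip_map_in_doubled_line)
qed

theorem theorem28:
  shows "\<exists>(X :: (real \<times> real) topology) (Y :: (real \<times> real) topology) f.
           t1_space X \<and> submetrizable_space X \<and>
           t1_space Y \<and> regular_space Y \<and> hereditarily paracompact_space Y \<and>
           first_countable Y \<and> \<not> submetrizable_space Y \<and>
           continuous_map X Y f \<and> f ` topspace X = topspace Y \<and>
           open_map X Y f \<and> closed_map X Y f"
proof (intro exI conjI)
  show sub: "submetrizable_space Michael_strip"
    unfolding Michael_strip_def
    by (intro submetrizable_discretize metrizable_space_subtopology metrizable_space_euclidean)
  then show "t1_space Michael_strip" by (rule submetrizable_imp_t1_space)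
  show "t1_space doubled_Michael_line" by (rule t1_space_doubled_Michael_line)
  then show "regular_space doubled_Michael_line"
    unfolding doubled_Michael_line_def
    by (intro regular_space_discretize regular_space_pullback_topology regular_space_euclidean)
  show "hereditarily paracompact_space doubled_Michael_line"
    unfolding doubled_Michael_line_def
    by (intro hereditarily_paracompact_discretize hereditarily_paracompact_pullback_topology)
  show "first_countable doubled_Michael_line"
    unfolding doubled_Michael_line_def
    by (intro first_countable_discretize first_countable_pullback_topology
        metrizable_imp_first_countable metrizable_space_euclidean)
  show "\<not> submetrizable_space doubled_Michael_line"
    by (rule not_submetrizable_doubled_Michael_line)
  show "strip_map ` topspace Michael_strip = topspace doubled_Michael_line"
    by (simp add: image_strip_map)
qed (rule continuous_map_strip_map open_map_strip_map closed_map_strip_map)+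

end
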